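(* The set $\{A\subset\mathbb{N}: \Pr(\Pr(A))=A\}$ has the cardinality of the continuum.
   Context: For $m\in\mathbb{N}$, $D(m)$ is the set of positive divisors of $m$. For $A\subset\mathbb{N}$, $S_A=\sum_{a\in A}a$ ($S_\emptyset=0$, $S_A=+\infty$ for infinite $A$), and $A$ is a practical set if every non-negative integer $k\le S_A$ is a sum of distinct elements of $A$. A number $m\in\mathbb{N}$ is $A$-practical if $D(m)\cap A$ is a practical set, and $\Pr(A)$ is the set of all $A$-practical numbers. *)

theory Defs
  imports "HOL-Library.Extended_Nat" "HOL-Library.Equipollence" Complex_Main
begin

text \<open>
  The natural numbers of the source are the positive integers; they are modelled here
  inside type \<^typ>\<open>nat\<close> by the condition \<open>0 < m\<close>, respectively \<open>A \<subseteq> {0<..}\<close>.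
\<close>

definition pos_divisors :: "nat \<Rightarrow> nat set" where
  "pos_divisors m = {d. 0 < d \<and> d dvd m}"

text \<open>The case distinction is needed since \<^const>\<open>sum\<close> is \<open>0\<close> on infinite sets.\<close>

definition set_sum :: "nat set \<Rightarrow> enat" where
  "set_sum A = (if finite A then enat (\<Sum>a\<in>A. a) else \<infinity>)"

definition practical_set :: "nat set \<Rightarrow> bool" where
  "practical_set A \<longleftrightarrow>
     (\<forall>k::nat. enat k \<le> set_sum A \<longrightarrow> (\<exists>B. B \<subseteq> A \<and> finite B \<and> k = (\<Sum>b\<in>B. b)))"

definition Pr :: "nat set \<Rightarrow> nat set" where
  "Pr A = {m. 0 < m \<and> practical_set (pos_divisors m \<inter> A)}"

end

theory Submission
  imports Defs "HOL-Analysis.Analysis" "HOL-Computational_Algebra.Primes"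
begin

text \<open>
  Whether \<open>m \<in> Pr A\<close> depends only on the divisors of \<open>m\<close> that lie in \<open>A\<close>, so a pair with
  \<open>B = Pr A\<close> and \<open>A = Pr B\<close> can be built one number at a time: the memberships of \<open>m\<close> in \<open>A\<close>
  and in \<open>B\<close> must solve two Boolean equations determined by the proper divisors of \<open>m\<close>. These
  equations are antitone, because deleting the largest element of a practical set leaves a practical
  set, and hence they are always solvable. For an odd prime, whose only proper divisor is \<open>1\<close>,
  they say exactly that \<open>m\<close> lies in one of \<open>A\<close> and \<open>B\<close> but not in both. So the odd primes
  in \<open>A\<close> can be prescribed arbitrarily, which yields continuum many fixed points.
\<close>

lemma practical_set_finite_def:
  assumes "finite X"
  shows "practical_set X \<longleftrightarrow> (\<forall>k \<le> \<Sum>X. \<exists>B\<subseteq>X. k = \<Sum>B)"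
proof -
  have "B \<subseteq> X \<and> finite B \<and> k = \<Sum>B \<longleftrightarrow> B \<subseteq> X \<and> k = \<Sum>B" for B and k :: nat
    using assms finite_subset by blast
  then show ?thesis
    using assms by (simp add: practical_set_def set_sum_def)
qed

text \<open>A representation of \<open>a - 1\<close> can only use elements below \<open>a\<close>,
  which gives necessity. Conversely, adding the elements in increasing order never opens a gap: the
  subset sums without and with the new greatest element \<open>b\<close> fill
  \<open>0..\<Sum>A\<close> and \<open>b..b + \<Sum>A\<close>, which overlap or are
  adjacent.\<close>

lemma practical_set_iff:
  assumes "finite X"
  shows "practical_set X \<longleftrightarrow> (\<forall>a\<in>X. a \<le> Suc (\<Sum>{x\<in>X. x < a}))"
proof
  assume X: "practical_set X"
  show "\<forall>a\<in>X. a \<le> Suc (\<Sum>{x\<in>X. x < a})"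
  proof
    fix a assume a: "a \<in> X"
    show "a \<le> Suc (\<Sum>{x\<in>X. x < a})"
    \<comment> \<open>Zero is split off because \<open>a - 1\<close> is truncated subtraction; the
      argument below needs \<open>a - 1 < a\<close>.\<close>
    proof (cases "a = 0")
      case False
      have "a \<le> \<Sum>X"
        using member_le_sum[of a X "\<lambda>x. x"] a assms by simp
      then obtain B where B: "B \<subseteq> X" "a - 1 = \<Sum>B"
        using X practical_set_finite_def[OF assms] by (meson diff_le_self le_trans)
      have "x < a" if "x \<in> B" for x
      proof -
        have "x \<le> \<Sum>B"
          using member_le_sum[of x B "\<lambda>x. x"] that B(1) assms by (simp add: finite_subset)
        then show ?thesis
          using B(2) False by linarith
      qed
      then have "\<Sum>B \<le> \<Sum>{x\<in>X. x < a}"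
        using B(1) assms by (intro sum_mono2) auto
      then show ?thesis
        using B(2) by linarith
    qed simp
  qed
next
  show "\<forall>a\<in>X. a \<le> Suc (\<Sum>{x\<in>X. x < a}) \<Longrightarrow> practical_set X"
    using assms
  proof (induction X rule: finite_linorder_max_induct)
    case empty
    show ?case by (simp add: practical_set_finite_def)
  next
    case (insert b A)
    have b: "b \<notin> A" using insert.hyps by auto
    have "{x \<in> insert b A. x < b} = A"
      using insert.hyps by auto
    then have b_le: "b \<le> Suc (\<Sum>A)"
      using insert.prems by (metis insertI1)
    have "{x \<in> insert b A. x < a} = {x \<in> A. x < a}" if "a \<in> A" for a
      using that insert.hyps by auto
    then have A: "\<forall>k \<le> \<Sum>A. \<exists>B\<subseteq>A. k = \<Sum>B"
      using insert by (simp add: practical_set_finite_def)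
    have "\<exists>B\<subseteq>insert b A. k = \<Sum>B" if k: "k \<le> \<Sum>(insert b A)" for k
    proof (cases "k \<le> \<Sum>A")
      case True
      then show ?thesis using A by blast
    next
      case False
      \<comment> \<open>Here \<open>b \<le> Suc (\<Sum>A) \<le> k\<close>, so \<open>b\<close> can
        be used as a summand and the remainder is within reach of \<open>A\<close>.\<close>
      then have "k - b \<le> \<Sum>A" "b \<le> k"
        using k b b_le insert.hyps(1) by auto
      then obtain B where B: "B \<subseteq> A" "k - b = \<Sum>B"
        using A by blast
      have "\<Sum>(insert b B) = b + \<Sum>B"
        using B(1) b insert.hyps(1) by (subst sum.insert) (auto intro: finite_subset)
      then show ?thesis
        using B \<open>b \<le> k\<close> by (intro exI[of _ "insert b B"]) auto
    qed
    then show ?case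
      using insert.hyps(1) by (simp add: practical_set_finite_def)
  qed
qed

text \<open>The criterion at an element looks only at smaller elements, so those of \<open>X\<close>
  never see \<open>m\<close>.\<close>

lemma practical_set_remove_greatest:
  assumes "practical_set (insert m X)" "finite X" "\<And>x. x \<in> X \<Longrightarrow> x < m"
  shows "practical_set X"
proof -
  have "{x \<in> insert m X. x < a} = {x \<in> X. x < a}" if "a \<in> X" for a
    using that assms(3) by force
  then show ?thesis
    using assms(1,2) by (simp add: practical_set_iff)
qed

lemma practical_set_empty: "practical_set {}"
  by (simp add: practical_set_iff)

lemma practical_set_singleton_1: "practical_set {1}"
  by (simp add: practical_set_iff)

lemma not_practical_set_1_insert:
  assumes "m > 2"
  shows "\<not> practical_set (insert m {1})"
proof -
  have "{x \<in> insert m {1}. x < m} = {1}"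
    using assms by auto
  then show ?thesis
    using assms by (auto simp: practical_set_iff)
qed

definition proper_divisors_in :: "nat \<Rightarrow> nat set \<Rightarrow> nat set" where
  "proper_divisors_in m A = {d \<in> pos_divisors m. d < m \<and> d \<in> A}"

lemma finite_proper_divisors_in [simp]: "finite (proper_divisors_in m A)"
  by (rule finite_subset[of _ "{..<m}"]) (auto simp: proper_divisors_in_def)

lemma proper_divisors_in_cong:
  assumes "\<And>d. d < m \<Longrightarrow> d \<in> A \<longleftrightarrow> d \<in> B"
  shows "proper_divisors_in m A = proper_divisors_in m B"
  using assms by (auto simp: proper_divisors_in_def)

lemma pos_divisors_Int:
  assumes "m > 0"
  shows "pos_divisors m \<inter> A =
    (if m \<in> A then insert m (proper_divisors_in m A) else proper_divisors_in m A)"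
  using assms by (auto simp: pos_divisors_def proper_divisors_in_def dest: dvd_imp_le
      intro!: le_neq_implies_less)

lemma mem_Pr_iff:
  assumes "m > 0"
  shows "m \<in> Pr A \<longleftrightarrow>
    (if m \<in> A then practical_set (insert m (proper_divisors_in m A))
     else practical_set (proper_divisors_in m A))"
  using assms by (simp add: Pr_def pos_divisors_Int)

text \<open>If \<open>p = p'\<close>, then \<open>b\<close> is forced to be \<open>p\<close> and
  determines \<open>a\<close>; the case \<open>q = q'\<close> is symmetric. Otherwise both equations
  say \<open>a = (\<not> b)\<close>, so \<open>a\<close> can be chosen to be
  \<open>c\<close>.\<close>

lemma antitone_bool_equations_solvable:
  assumes "p' \<longrightarrow> p" "q' \<longrightarrow> q"
  obtains a b where "b \<longleftrightarrow> (if a then p' else p)" "a \<longleftrightarrow> (if b then q' else q)"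
    "p \<and> \<not> p' \<and> q \<and> \<not> q' \<longrightarrow> a = c"
proof -
  have "\<exists>a b. (b \<longleftrightarrow> (if a then p' else p)) \<and> (a \<longleftrightarrow> (if b then q' else q)) \<and>
      (p \<and> \<not> p' \<and> q \<and> \<not> q' \<longrightarrow> a = c)"
    unfolding ex_bool_eq using assms by (cases p; cases q; simp; blast)
  then show ?thesis
    using that by blast
qed

lemma proper_divisors_in_1: "proper_divisors_in 1 A = {}"
  by (auto simp: proper_divisors_in_def pos_divisors_def)

lemma proper_divisors_in_prime:
  assumes "prime p" "1 \<in> A"
  shows "proper_divisors_in p A = {1}"
  using assms prime_gt_1_nat[OF assms(1)]
  by (auto simp: proper_divisors_in_def pos_divisors_def prime_nat_iff)

lemma Pr_swapped_pair_exists: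
  fixes Q :: "nat set"
  obtains A B where "A \<subseteq> {0<..}" "Pr A = B" "Pr B = A"
    "\<And>p. prime p \<Longrightarrow> p > 2 \<Longrightarrow> p \<in> A \<longleftrightarrow> p \<in> Q"
proof -
  \<comment> \<open>The membership bit \<open>a\<close> of \<open>m\<close> is kept apart from
    \<open>A\<close>, so that \<open>E A m a\<close> depends on \<open>A\<close> only below
    \<open>m\<close> and can serve in a recursion.\<close>
  define E :: "nat set \<Rightarrow> nat \<Rightarrow> bool \<Rightarrow> bool" where
    "E A m a = (if a then practical_set (insert m (proper_divisors_in m A))
                else practical_set (proper_divisors_in m A))" for A m a
  define P :: "(nat \<Rightarrow> bool \<times> bool) \<Rightarrow> nat \<Rightarrow> bool \<times> bool \<Rightarrow> bool" where
    "P f m r \<longleftrightarrow> (if m = 0 then r = (False, False)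
       else (snd r \<longleftrightarrow> E {d. fst (f d)} m (fst r)) \<and> (fst r \<longleftrightarrow> E {d. snd (f d)} m (snd r))
         \<and> (prime m \<and> m > 2 \<longrightarrow> (fst r \<longleftrightarrow> m \<in> Q)))" for f m r
  \<comment> \<open>The components of \<open>f m\<close> encode the membership of \<open>m\<close> in \<open>A\<close> and in \<open>B\<close>.\<close>
  have "\<exists>f. \<forall>m. P f m (f m)"
  \<comment> \<open>The equations at \<open>m\<close> may have several solutions, so the recursion
    chooses one, and \<open>P f m\<close> must read \<open>f\<close> only below
    \<open>m\<close>.\<close>
  proof (rule dependent_wf_choice[where R = less_than])
    fix f g :: "nat \<Rightarrow> bool \<times> bool" and m r
    assume "\<And>z. (z, m) \<in> less_than \<Longrightarrow> f z = g z"
    then have "proper_divisors_in m {d. fst (f d)} = proper_divisors_in m {d. fst (g d)}"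
      "proper_divisors_in m {d. snd (f d)} = proper_divisors_in m {d. snd (g d)}"
      by (auto intro!: proper_divisors_in_cong)
    then show "P f m r = P g m r"
      by (simp add: P_def E_def)
  next
    fix m and f :: "nat \<Rightarrow> bool \<times> bool"
    assume IH: "\<And>y. (y, m) \<in> less_than \<Longrightarrow> P f y (f y)"
    show "\<exists>r. P f m r"
    proof (cases "m = 0")
      case True
      then show ?thesis by (simp add: P_def)
    next
      case False
      have mono: "E S m True \<longrightarrow> E S m False" for S
        unfolding E_def
        by (auto intro: practical_set_remove_greatest simp: proper_divisors_in_def)
      let ?A = "{d. fst (f d)}" and ?B = "{d. snd (f d)}"
      obtain a b where ab:
        "b \<longleftrightarrow> (if a then E ?A m True else E ?A m False)"
        "a \<longleftrightarrow> (if b then E ?B m True else E ?B m False)"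
        "E ?A m False \<and> \<not> E ?A m True \<and> E ?B m False \<and> \<not> E ?B m True \<longrightarrow> a = (m \<in> Q)"
        by (rule antitone_bool_equations_solvable[OF mono[of ?A] mono[of ?B], where c = "m \<in> Q"])
      have "a \<longleftrightarrow> m \<in> Q" if m: "prime m" "m > 2"
      proof (rule ab(3)[THEN mp])
        \<comment> \<open>Both \<open>{}\<close> and \<open>{1}\<close> are practical, so the
          equations at 1 force it into both sets. Hence at an odd prime \<open>m\<close> both sets
          of proper divisors are \<open>{1}\<close>, which is practical while \<open>{1, m}\<close>
          is not: this is the case with a free choice.\<close>
        have "E S 1 a" for S a
          using practical_set_empty practical_set_singleton_1
          unfolding E_def proper_divisors_in_1 by simp
        moreover have "P f 1 (f 1)"
          using IH m by simp
        ultimately have "fst (f 1)" "snd (f 1)"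
          unfolding P_def by simp_all
        then show "E ?A m False \<and> \<not> E ?A m True \<and> E ?B m False \<and> \<not> E ?B m True"
          using m practical_set_singleton_1 not_practical_set_1_insert
          by (simp add: E_def proper_divisors_in_prime)
      qed
      with ab(1,2) False have "P f m (a, b)"
        by (auto simp: P_def)
      then show ?thesis ..
    qed
  qed simp
  then obtain f where f: "\<And>m. P f m (f m)" by blast
  define A where "A = {d. fst (f d)}"
  define B where "B = {d. snd (f d)}"
  have f0: "0 \<notin> A" "0 \<notin> B"
    using f[of 0] by (auto simp: P_def A_def B_def)
  have Pr_E: "m \<in> Pr S \<longleftrightarrow> m \<noteq> 0 \<and> E S m (m \<in> S)" for S m
    using mem_Pr_iff[of m S] by (auto simp: E_def Pr_def)
  have AB: "m \<in> B \<longleftrightarrow> E A m (m \<in> A)" "m \<in> A \<longleftrightarrow> E B m (m \<in> B)" if "m \<noteq> 0" for m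
    using f[of m] unfolding P_def if_not_P[OF that] A_def B_def mem_Collect_eq by blast+
  have "m \<in> Pr A \<longleftrightarrow> m \<in> B" for m
    unfolding Pr_E using AB(1)[of m] f0 by (cases "m = 0") simp_all
  moreover have "m \<in> Pr B \<longleftrightarrow> m \<in> A" for m
    unfolding Pr_E using AB(2)[of m] f0 by (cases "m = 0") simp_all
  moreover have "p \<in> A \<longleftrightarrow> p \<in> Q" if "prime p" "p > 2" for p
  proof -
    have "p \<noteq> 0" using that by simp
    then show ?thesis
      using f[of p] that unfolding P_def if_not_P[OF \<open>p \<noteq> 0\<close>] A_def mem_Collect_eq by blast
  qed
  moreover have "A \<subseteq> {0<..}"
    using f0 by (auto intro: gr0I)
  ultimately show ?thesis
    by (intro that[of A B]) blast+
qed

lemma infinite_odd_primes: "infinite {p::nat. prime p \<and> p > 2}"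
proof
  assume "finite {p::nat. prime p \<and> p > 2}"
  then have "finite ({p::nat. prime p \<and> p > 2} \<union> {..2})" by simp
  moreover have "{p::nat. prime p} \<subseteq> {p. prime p \<and> p > 2} \<union> {..2}" by auto
  ultimately show False
    using primes_infinite finite_subset by blast
qed

theorem theorem4p16:
  "{A :: nat set. A \<subseteq> {0<..} \<and> Pr (Pr A) = A} \<approx> (UNIV :: real set)"
proof -
  let ?F = "{A :: nat set. A \<subseteq> {0<..} \<and> Pr (Pr A) = A}"
  obtain e :: "nat \<Rightarrow> nat" where e: "inj e" "range e \<subseteq> {p. prime p \<and> p > 2}"
    using infinite_odd_primes infinite_countable_subset by blast
  have "Q \<in> vimage e ` ?F" for Q
  proof -
    obtain A B where AB: "A \<subseteq> {0<..}" "Pr A = B" "Pr B = A"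
      "\<And>p. prime p \<Longrightarrow> p > 2 \<Longrightarrow> p \<in> A \<longleftrightarrow> p \<in> e ` Q"
      using Pr_swapped_pair_exists by metis
    have "e n \<in> A \<longleftrightarrow> n \<in> Q" for n
      using AB(4)[of "e n"] e by (simp add: subset_iff inj_image_mem_iff)
    then have "Q = e -` A" by auto
    with AB(1-3) show ?thesis by blast
  qed
  then have "(UNIV :: nat set set) \<lesssim> ?F"
    by (intro subset_image_lepoll[of _ "vimage e"]) blast
  moreover have "?F \<lesssim> (UNIV :: nat set set)"
    by (simp add: subset_imp_lepoll)
  ultimately show ?thesis
    using lepoll_antisym nat_sets_eqpoll_reals eqpoll_trans by blast
qed

end
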